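(* Let $A$ be a string of length $n\ge 1$ over $\{\mathrm{H},\mathrm{T}\}$, chosen by Alice, that starts with an odd number of $\mathrm{H}$s, i.e. the maximal initial run of $\mathrm{H}$s in $A$ has odd length. Then Bob, choosing his string afterward, can force a loss for himself: there exists a string $B\neq A$ of length $n$ such that Alice wins the No-Flippancy game with Alice's string $A$ and Bob's string $B$.
   Context: No-Flippancy game: Alice and Bob have distinct strings $A=A_1\cdots A_n$ and $B=B_1\cdots B_n$ of the same length $n$ over the alphabet $\{\mathrm{H},\mathrm{T}\}$. Starting from the empty sequence, the players alternate turns, Alice going first, and on each turn the current player appends one letter to the sequence (the game output) as follows: let $i<n$ be the maximal length of a suffix of the current sequence that coincides with a prefix of the current player's string ($i=0$ is allowed, via the empty suffix); the player appends the letter with index $i+1$ of their own string. The game ends as soon as $A$ or $B$ appears as a block of consecutive letters in the sequence (necessarily as its suffix, no matter who made the last move); the player whose string appears first wins and the other loses. If neither string ever appears, the game is infinite (nobody wins). *)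

theory Defs
  imports Main "HOL-Library.Sublist"
begin

datatype coin = H | T

text \<open>The letter appended by a player with string \<open>X\<close> when the current sequence is \<open>s\<close>.
  With 0-based list indexing, the letter number \<open>i + 1\<close> of \<open>X\<close> is \<open>X ! i\<close>.
  For nonempty \<open>X\<close> the set below is finite and contains \<open>0\<close>.\<close>

definition next_letter :: "coin list \<Rightarrow> coin list \<Rightarrow> coin" where
  "next_letter X s = X ! Max {i. i < length X \<and> suffix (take i X) s}"

definition game_over :: "coin list \<Rightarrow> coin list \<Rightarrow> coin list \<Rightarrow> bool" where
  "game_over A B s \<longleftrightarrow> sublist A s \<or> sublist B s"

text \<open>The sequence after \<open>k\<close> turns; once the game is over it no longer changes.
  Turns are numbered from \<open>0\<close>, so Alice (string \<open>A\<close>) moves in the even turns.\<close>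

fun game_seq :: "coin list \<Rightarrow> coin list \<Rightarrow> nat \<Rightarrow> coin list" where
  "game_seq A B 0 = []"
| "game_seq A B (Suc k) =
    (let s = game_seq A B k
     in if game_over A B s then s
        else s @ [next_letter (if even k then A else B) s])"

definition alice_wins :: "coin list \<Rightarrow> coin list \<Rightarrow> bool" where
  "alice_wins A B \<longleftrightarrow>
    (\<exists>k. sublist A (game_seq A B k) \<and> (\<forall>j\<le>k. \<not> sublist B (game_seq A B j)))"

end

theory Submission
  imports Defs
begin

text \<open>Bob takes Alice's string without its first letter, followed by \<open>T\<close>. Then the output is
  exactly \<open>A\<close>: on his turn Bob sees a prefix of \<open>A\<close> of odd length \<open>k\<close>, whose last \<open>k - 1\<close> letters
  form a prefix of \<open>B\<close>, and continuing \<open>B\<close> continues \<open>A\<close>. The only danger is that all \<open>k\<close> letters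
  form a prefix of \<open>B\<close>; this forces \<open>A\<close> to start with \<open>k + 1\<close> heads, hence with \<open>k + 2\<close> of them by
  parity, and Bob still appends the right letter.\<close>

lemma next_letter_eq:
  assumes "i < length X" "suffix (take i X) s"
    and "\<And>j. j < length X \<Longrightarrow> suffix (take j X) s \<Longrightarrow> j \<le> i"
  shows "next_letter X s = X ! i"
proof -
  have "Max {i. i < length X \<and> suffix (take i X) s} = i"
    using assms by (intro Max_eqI) auto
  then show ?thesis by (simp add: next_letter_def)
qed

lemma suffix_take_le:
  assumes "j < length X" "suffix (take j X) s"
  shows "j \<le> length s"
  using suffix_length_le[OF assms(2)] assms(1) by simp

lemma next_letter_own_prefix:
  assumes "k < length X"
  shows "next_letter X (take k X) = X ! k"
  using assms suffix_take_le[of _ X "take k X"] by (intro next_letter_eq) auto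

lemma next_letter_shifted:
  assumes odd_run: "odd (length (takeWhile (\<lambda>c. c = H) A))"
    and k: "k < length A" "odd k"
  shows "next_letter (tl A @ [x]) (take k A) = A ! k"
proof -
  let ?B = "tl A @ [x]" and ?m = "length (takeWhile (\<lambda>c. c = H) A)"
  have len: "length ?B = length A" using k by simp
  have nth_B: "?B ! i = A ! Suc i" if "Suc i < length A" for i
    using that by (auto simp: nth_append nth_tl)
  have "A ! 0 = H"
    using odd_run by (cases A) (auto split: if_splits)
  \<comment> \<open>So Bob always matches at least \<open>k - 1\<close> letters, and at most
    \<open>k\<close> of them by \<open>le\<close>: only two match lengths are possible.\<close>
  have drop: "take (k - 1) ?B = drop 1 (take k A)"
    using k by (simp add: drop_take drop_Suc)
  have le: "j \<le> k" if "j < length ?B" "suffix (take j ?B) (take k A)" for j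
    using suffix_take_le[OF that] k by simp
  show ?thesis
  proof (cases "suffix (take k ?B) (take k A)")
    case True
    then obtain u where u: "take k A = u @ take k ?B" by (auto simp: suffix_def)
    then have "length (take k A) = length u + length (take k ?B)"
      by (metis length_append)
    then have "u = []"
      using k len by (simp only: length_take) auto
    with u have eq: "take k ?B = take k A" by simp
    \<comment> \<open>\<open>?B\<close> is \<open>A\<close> shifted by one place, so a common prefix
      of length \<open>k\<close> makes consecutive letters of \<open>A\<close> equal.\<close>
    have "A ! Suc i = A ! i" if "i < k" for i
      using nth_B[of i] nth_take[OF that] eq that k by (metis Suc_leI order_le_less_trans)
    then have heads: "A ! i = H" if "i \<le> k" for i
      using that by (induction i) (auto simp: \<open>A ! 0 = H\<close>)
    have "Suc k \<le> ?m"
    proof (rule ccontr)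
      assume "\<not> Suc k \<le> ?m"
      then show False
        using heads[of ?m] nth_length_takeWhile[of "\<lambda>c. c = H" A] k by simp
    qed
    with odd_run k have "Suc k < ?m"
      by (metis even_Suc le_neq_implies_less)
    \<comment> \<open>The strict inequality also keeps \<open>Suc k\<close> inside \<open>A\<close>,
      so that \<open>?B ! k\<close> is a letter of \<open>A\<close> and not the appended
      \<open>x\<close>.\<close>
    then have next_head: "A ! Suc k = H" and "Suc k < length A"
      using nth_mem[of "Suc k" "takeWhile (\<lambda>c. c = H) A"] length_takeWhile_le[of "\<lambda>c. c = H" A]
      by (auto simp: takeWhile_nth dest: set_takeWhileD)
    have "next_letter ?B (take k A) = ?B ! k"
      using True k len le by (intro next_letter_eq) auto
    then show ?thesis
      using nth_B[OF \<open>Suc k < length A\<close>] next_head heads[of k] by simp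
  next
    case False
    have "next_letter ?B (take k A) = ?B ! (k - 1)"
    proof (rule next_letter_eq)
      show "k - 1 < length ?B" using k len by linarith
      show "suffix (take (k - 1) ?B) (take k A)"
        unfolding drop by (rule suffix_drop)
      show "j \<le> k - 1" if j: "j < length ?B" "suffix (take j ?B) (take k A)" for j
      proof -
        have "j \<noteq> k" using False j(2) by blast
        then show ?thesis using le[OF j] by linarith
      qed
    qed
    \<comment> \<open>Since \<open>k\<close> is odd, it is positive, so \<open>k - 1\<close> is a
      true predecessor and the shift turns index \<open>k - 1\<close> of \<open>?B\<close> into
      index \<open>k\<close> of \<open>A\<close>.\<close>
    then show ?thesis
      using nth_B[of "k - 1"] k odd_pos[of k] by simp
  qed
qed

text \<open>Every letter equals its successor and the last one is \<open>x\<close>. With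
  \<open>x = T\<close> this would leave \<open>A\<close> an initial run of heads of length 0, which
  is even; hence Bob's string differs from Alice's.\<close>

lemma tl_snoc_eq_imp_replicate:
  assumes "tl A @ [x] = A"
  shows "A = replicate (length A) x"
  using assms
proof (induction A)
  case (Cons a A)
  from Cons.prems have eq: "A @ [x] = a # A" by simp
  then show ?case
  proof (cases A)
    case (Cons b A')
    with eq have "tl A @ [x] = A" by simp
    with Cons.IH have "A = replicate (length A) x" by simp
    with eq show ?thesis
      by (metis Cons hd_append2 length_Cons list.sel(1) list.simps(3) replicate_Suc)
  qed simp
qed simp

theorem lemma12:
  fixes A :: "coin list" and n :: nat
  assumes "n \<ge> 1"
    and "length A = n"
    and "odd (length (takeWhile (\<lambda>c. c = H) A))"
  shows "\<exists>B. length B = n \<and> B \<noteq> A \<and> alice_wins A B"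
proof -
  let ?B = "tl A @ [T]"
  have len: "length ?B = n" using assms(1,2) by simp
  have ne: "?B \<noteq> A"
  proof
    assume "?B = A"
    then have A: "A = replicate n T"
      using tl_snoc_eq_imp_replicate[of A T] assms(2) by simp
    have "takeWhile (\<lambda>c. c = H) A = []"
      by (subst A) simp
    with assms(3) show False by simp
  qed
  have seq: "game_seq A ?B k = take k A" if "k \<le> n" for k
    using that
  proof (induction k)
    case (Suc k)
    then have k: "k < length A" using assms(2) by simp
    \<comment> \<open>Fewer than \<open>n\<close> letters have been played, too few to contain
      either string.\<close>
    have "\<not> game_over A ?B (take k A)"
      using k len assms(2) by (auto simp: game_over_def dest!: sublist_length_le)
    moreover have "next_letter (if even k then A else ?B) (take k A) = A ! k"
      using next_letter_own_prefix[OF k] next_letter_shifted[OF assms(3) k] by simp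
    ultimately show ?case
      using Suc k by (simp add: Let_def take_Suc_conv_app_nth)
  qed simp
  \<comment> \<open>This includes the final output \<open>A\<close> itself: a block of full length
    \<open>n\<close> in \<open>A\<close> would be all of \<open>A\<close>, contrary to
    \<open>ne\<close>.\<close>
  have "\<not> sublist ?B (take j A)" for j
  proof
    assume "sublist ?B (take j A)"
    then have "sublist ?B A"
      using sublist_order.order_trans sublist_take by blast
    then obtain u v where A: "A = u @ ?B @ v" by (auto simp: sublist_def)
    have "length A = length u + (length ?B + length v)"
      by (metis A length_append)
    then have "u = []" "v = []" unfolding len assms(2) by auto
    with A show False using ne by simp
  qed
  then have "alice_wins A ?B"
    unfolding alice_wins_def using seq assms(2) by (intro exI[of _ n]) auto
  with len ne show ?thesis by blast
qed

end
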